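(* Let $(\leq_A)_{A \subseteq S}$ be a family of binary relations on acts satisfying postulates (Q1)--(Q6), and let $\leq$ be the relation on events defined by it. Let $A, B, D \subseteq S$ with $A \cap D = B \cap D = \emptyset$. If $A \cup D \leq B \cup D$ and $(D \cup B) \not\leq D$, then $A \leq B$.
   Context: $S$ is a non-empty set of states, $F$ a set of consequences; events are arbitrary subsets of $S$; acts are arbitrary functions $S \to F$. For each event $A$ a binary relation $\leq_A$ on acts is given. Write $f \sim_A g$ for ($f \leq_A g$ and $g \leq_A f$), $f <_A g$ for ($f \leq_A g$ and not $g \leq_A f$), and $f =_A g$ if $f(s)=g(s)$ for all $s \in A$. An event $A$ is null if $h \leq_A h'$ for all acts $h,h'$. For disjoint $A,B$, write $A \,\mathcal{N}\, B$ if for all acts $h,h'$: $h \leq_{A\cup B} h' \Leftrightarrow h \leq_B h'$. A consequence $c\in F$ is identified with the constant act with value $c$. For consequences, $c \leq d$ (without subscript) means $c \leq_B d$ for every event $B$ (under (Q5), if some event is non-null, this is equivalent to $c \leq_A d$ for one, equivalently every, non-null $A$), and $d < c$ means $d \leq c$ and not $c \leq d$. $w_A^{c,d}$ is the act with value $c$ on $A$ and $d$ on $S \setminus A$. Postulates (for all acts $f,g,h$ and events $A,B$): (Q1) $f \leq_A g$ and $g \leq_A h$ imply $f \leq_A h$. (Q2) $f =_A g$ implies $f \sim_A g$. (Q3) if $A \cap B = \emptyset$, $f \leq_A g$ and $f \sim_B g$, then $f \leq_{A \cup B} g$. (Q4) if $A \cap B = \emptyset$, $f \leq_{A\cup B}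 g$ and $f \sim_B g$, then either $f \leq_A g$ or $A \,\mathcal{N}\, B$. (Q5) if $c,d$ are constant acts, $A$ is not null and $c \leq_A d$, then $c \leq_B d$ for every event $B$. (Q6) there are consequences $c,d$ with $d < c$. Relation on events defined by the family: for events $A,B$, $A \leq B$ iff for all consequences $c,d$ with $d < c$, $w_A^{c,d} \leq_{A\cup B} w_B^{c,d}$. *)

theory Defs
  imports Main
begin

text \<open>
  The state space \<open>S\<close> is the (non-empty) type \<open>'s\<close>, the set \<open>F\<close> of consequences is the
  type \<open>'f\<close>; an event is any \<open>A :: 's set\<close>, an act any \<open>f :: 's \<Rightarrow> 'f\<close>.  In a
  family \<open>R\<close>, the proposition \<open>R A f g\<close> stands for \<open>f \<le>\<^sub>A g\<close>.
\<close>

type_synonym ('s, 'f) act = "'s \<Rightarrow> 'f"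
type_synonym ('s, 'f) pref_family = "'s set \<Rightarrow> ('s, 'f) act \<Rightarrow> ('s, 'f) act \<Rightarrow> bool"

definition indiff :: "('s, 'f) pref_family \<Rightarrow> 's set \<Rightarrow> ('s, 'f) act \<Rightarrow> ('s, 'f) act \<Rightarrow> bool" where
  "indiff R A f g \<longleftrightarrow> R A f g \<and> R A g f"

definition agree_on :: "'s set \<Rightarrow> ('s, 'f) act \<Rightarrow> ('s, 'f) act \<Rightarrow> bool" where
  "agree_on A f g \<longleftrightarrow> (\<forall>s\<in>A. f s = g s)"

definition null_event :: "('s, 'f) pref_family \<Rightarrow> 's set \<Rightarrow> bool" where
  "null_event R A \<longleftrightarrow> (\<forall>h h'. R A h h')"

text \<open>The relation \<open>A N B\<close>; it is only meaningful for disjoint events.\<close>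

definition negligible :: "('s, 'f) pref_family \<Rightarrow> 's set \<Rightarrow> 's set \<Rightarrow> bool" where
  "negligible R A B \<longleftrightarrow> A \<inter> B = {} \<and> (\<forall>h h'. R (A \<union> B) h h' \<longleftrightarrow> R B h h')"

definition const_act :: "'f \<Rightarrow> ('s, 'f) act" where
  "const_act c = (\<lambda>_. c)"

definition conseq_le :: "('s, 'f) pref_family \<Rightarrow> 'f \<Rightarrow> 'f \<Rightarrow> bool" where
  "conseq_le R c d \<longleftrightarrow> (\<forall>B. R B (const_act c) (const_act d))"

definition conseq_less :: "('s, 'f) pref_family \<Rightarrow> 'f \<Rightarrow> 'f \<Rightarrow> bool" where
  "conseq_less R d c \<longleftrightarrow> conseq_le R d c \<and> \<not> conseq_le R c d"

text \<open>\<open>bet A c d\<close> is \<open>w\<close> with subscript \<open>A\<close> and superscripts \<open>c, d\<close>.\<close>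

definition bet :: "'s set \<Rightarrow> 'f \<Rightarrow> 'f \<Rightarrow> ('s, 'f) act" where
  "bet A c d = (\<lambda>s. if s \<in> A then c else d)"

definition event_le :: "('s, 'f) pref_family \<Rightarrow> 's set \<Rightarrow> 's set \<Rightarrow> bool" where
  "event_le R A B \<longleftrightarrow>
     (\<forall>c d. conseq_less R d c \<longrightarrow> R (A \<union> B) (bet A c d) (bet B c d))"

locale conditional_preferences =
  fixes R :: "('s, 'f) pref_family"
  assumes Q1: "\<And>A f g h. R A f g \<Longrightarrow> R A g h \<Longrightarrow> R A f h"
    and Q2: "\<And>A f g. agree_on A f g \<Longrightarrow> indiff R A f g"
    and Q3: "\<And>A B f g. A \<inter> B = {} \<Longrightarrow> R A f g \<Longrightarrow> indiff R B f g \<Longrightarrow> R (A \<union> B) f g"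
    and Q4: "\<And>A B f g. A \<inter> B = {} \<Longrightarrow> R (A \<union> B) f g \<Longrightarrow> indiff R B f g
               \<Longrightarrow> R A f g \<or> negligible R A B"
    and Q5: "\<And>A B c d. \<not> null_event R A \<Longrightarrow> R A (const_act c) (const_act d)
               \<Longrightarrow> R B (const_act c) (const_act d)"
    and Q6: "\<exists>c d. conseq_less R d c"

end

theory Submission
  imports Defs
begin

text \<open>
  Since the two bets on \<open>A \<union> D\<close> and \<open>B \<union> D\<close> agree on \<open>D\<close>, postulate (Q4) yields the claim
  unless \<open>A \<union> B\<close> is negligible relative to \<open>D\<close>. In that case the bets on \<open>D \<union> B\<close> and \<open>D\<close>
  are equivalent given \<open>A \<union> B \<union> D\<close>, although not given \<open>B \<union> D\<close>; as they agree on \<open>A - B\<close>,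
  (Q4) makes \<open>B \<union> D\<close> negligible relative to \<open>A - B\<close>. So preferences given \<open>A - B\<close> and given \<open>D\<close>
  are the same. By (Q5) this forces \<open>D\<close>, and hence \<open>A - B\<close>, to be null, and for null \<open>A - B\<close>
  the claim is dominance.
\<close>

context conditional_preferences
begin

lemma cong_on:
  assumes "agree_on E f f'" "agree_on E g g'" "R E f g"
  shows "R E f' g'"
  using Q1[of E f' f g'] Q1[of E f g g'] Q2[OF assms(1)] Q2[OF assms(2)] assms(3)
  unfolding indiff_def by blast

text \<open>On \<open>B - A\<close> the bets are the constants \<open>d\<close> and
  \<open>c\<close>, on \<open>A \<inter> B\<close> they agree, and \<open>A - B\<close> is null;
  (Q3) glues the three pieces.\<close>

lemma event_le_if_Diff_null:
  assumes "null_event R (A - B)"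
  shows "event_le R A B"
  unfolding event_le_def
proof (intro allI impI)
  fix c d assume "conseq_less R d c"
  then have "R (B - A) (const_act d) (const_act c)"
    by (simp add: conseq_less_def conseq_le_def)
  then have "R (B - A) (bet A c d) (bet B c d)"
    by (rule cong_on[rotated 2]) (auto simp: agree_on_def bet_def const_act_def)
  moreover have "indiff R (A \<inter> B) (bet A c d) (bet B c d)"
    by (rule Q2) (auto simp: agree_on_def bet_def)
  ultimately have "R ((B - A) \<union> (A \<inter> B)) (bet A c d) (bet B c d)"
    by (intro Q3) auto
  moreover have "indiff R (A - B) (bet A c d) (bet B c d)"
    using assms by (simp add: null_event_def indiff_def)
  ultimately have "R (((B - A) \<union> (A \<inter> B)) \<union> (A - B)) (bet A c d) (bet B c d)"
    by (rule Q3[rotated]) auto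
  moreover have "((B - A) \<union> (A \<inter> B)) \<union> (A - B) = A \<union> B" by auto
  ultimately show "R (A \<union> B) (bet A c d) (bet B c d)" by simp
qed

lemma Diff_null_if_negligible:
  assumes "A \<inter> D = {}" and "B \<inter> D = {}"
    and neg: "negligible R (A \<union> B) D"
    and nle: "\<not> event_le R (D \<union> B) D"
  shows "null_event R (A - B)"
proof -
  obtain c d where less: "conseq_less R d c"
    and nR: "\<not> R (D \<union> B) (bet (D \<union> B) c d) (bet D c d)"
    using nle by (auto simp: event_le_def Un_ac)
  have indD: "indiff R D (bet (D \<union> B) c d) (bet D c d)"
    by (rule Q2) (auto simp: agree_on_def bet_def)
  \<comment> \<open>Otherwise (Q3) would glue \<open>B\<close> to \<open>D\<close>, where the bets
    agree, against \<open>nR\<close>. By (Q5) this will force \<open>D\<close> to be null.\<close>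
  have nB: "\<not> R B (const_act c) (const_act d)"
  proof
    assume "R B (const_act c) (const_act d)"
    then have "R B (bet (D \<union> B) c d) (bet D c d)"
      by (rule cong_on[rotated 2]) (use assms(2) in \<open>auto simp: agree_on_def bet_def const_act_def\<close>)
    then have "R (B \<union> D) (bet (D \<union> B) c d) (bet D c d)"
      using indD assms(2) by (intro Q3) auto
    with nR show False by (simp add: Un_commute)
  qed
  have "R (A \<union> B \<union> D) (bet (D \<union> B) c d) (bet D c d)"
    using neg indD by (simp add: negligible_def indiff_def)
  moreover have T: "A \<union> B \<union> D = (D \<union> B) \<union> (A - B)" by auto
  moreover have "indiff R (A - B) (bet (D \<union> B) c d) (bet D c d)"
    by (rule Q2) (use assms(1) in \<open>auto simp: agree_on_def bet_def\<close>)
  ultimately have "negligible R (D \<union> B) (A - B)"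
    using Q4[of "D \<union> B" "A - B"] nR assms(1) by auto
  \<comment> \<open>Both negligibility facts concern the same union
    \<open>A \<union> B \<union> D\<close>.\<close>
  with neg T have same: "R (A - B) h h' \<longleftrightarrow> R D h h'" for h h'
    unfolding negligible_def by metis
  \<comment> \<open>The bet on \<open>D\<close> is \<open>d\<close> throughout \<open>A - B\<close>
    but \<open>c\<close> on \<open>D\<close>, so moving this along \<open>same\<close> compares
    \<open>c\<close> with \<open>d\<close> given \<open>D\<close>.\<close>
  have "indiff R (A - B) (bet D c d) (const_act d)"
    by (rule Q2) (use assms(1) in \<open>auto simp: agree_on_def bet_def const_act_def\<close>)
  then have "R D (bet D c d) (const_act d)" by (simp add: same indiff_def)
  then have "R D (const_act c) (const_act d)"
    by (rule cong_on[rotated 2]) (auto simp: agree_on_def bet_def const_act_def)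
  with nB Q5 have "null_event R D" by blast
  then show ?thesis by (simp add: null_event_def same)
qed

end

theorem lemma12:
  fixes R :: "('s, 'f) pref_family" and A B D :: "'s set"
  assumes "conditional_preferences R"
    and "A \<inter> D = {}" and "B \<inter> D = {}"
    and "event_le R (A \<union> D) (B \<union> D)"
    and "\<not> event_le R (D \<union> B) D"
  shows "event_le R A B"
proof (cases "negligible R (A \<union> B) D")
  interpret conditional_preferences R by fact
  case True
  then show ?thesis
    using Diff_null_if_negligible event_le_if_Diff_null assms(2,3,5) by blast
next
  interpret conditional_preferences R by fact
  case False
  show ?thesis
    unfolding event_le_def
  proof (intro allI impI)
    fix c d assume "conseq_less R d c"
    with assms(4) have "R ((A \<union> D) \<union> (B \<union> D)) (bet (A \<union> D) c d) (bet (B \<union> D) c d)"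
      by (simp add: event_le_def)
    moreover have "(A \<union> D) \<union> (B \<union> D) = (A \<union> B) \<union> D" by auto
    moreover have "indiff R D (bet (A \<union> D) c d) (bet (B \<union> D) c d)"
      by (rule Q2) (auto simp: agree_on_def bet_def)
    ultimately have "R (A \<union> B) (bet (A \<union> D) c d) (bet (B \<union> D) c d)"
      using Q4[of "A \<union> B" D] False assms(2,3) by (metis Int_Un_distrib2 Un_empty)
    \<comment> \<open>\<open>D\<close> misses \<open>A \<union> B\<close>, so dropping it changes
      neither bet there.\<close>
    then show "R (A \<union> B) (bet A c d) (bet B c d)"
      by (rule cong_on[rotated 2]) (use assms(2,3) in \<open>auto simp: agree_on_def bet_def\<close>)
  qed
qed

end
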